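(* Let $\kappa\in(0,\beta)$ be such that $\varphi(\kappa)=\mathbb{E}[e^{\kappa X_1}]=1$, let $\mathbf v^{(\kappa)}=(v_1^{(\kappa)},v_2^{(\kappa)})^T$ be the right eigenvector with positive entries of $\hat{\mathbf F}[\kappa]$ corresponding to its (Perron–Frobenius) eigenvalue $\lambda(\kappa)=1$, and let $\mathbb{E}^{(\kappa)}_2$ denote expectation under the measure $\mathbb{Q}^{(\kappa)}_2$ defined by $$\frac{d\mathbb{Q}^{(\kappa)}_2}{d\mathbb{P}_2}\Big|_{\mathcal F_n}=e^{\kappa S_n}\frac{v^{(\kappa)}_{J_n}}{v^{(\kappa)}_{J_0}},\qquad n\geq0.$$ Then for every initial reserve $x\geq0$ the ruin probability equals $$\psi(x)=v_2^{(\kappa)}\,e^{-\kappa x}\;\mathbb{E}^{(\kappa)}_2\!\left[\frac{e^{-\kappa\,\varepsilon(T^{(2)}(x))}}{v^{(\kappa)}_{J_{T^{(2)}(x)}}}\right],$$ where $\varepsilon(T^{(2)}(x))=S_{T^{(2)}(x)}-x$ is the overshoot at the time of ruin $T^{(2)}(x)=\inf\{n\in\mathbb{N}:S_n>x\}$ (with $S_0=0$, $J_0=2$).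
   Context: Risk model: let $\xi>0$ and $\tau\sim\mathrm{Exp}(\lambda_1)$, $\tilde\tau\sim\mathrm{Exp}(\lambda_2)$, $Y\sim\mathrm{Exp}(\beta)$ (parameters are rates, all positive). Claim sizes $Y_1,Y_2,\dots$ are i.i.d. copies of $Y$, independent of claim arrivals. The first inter-arrival time is distributed as $\tilde\tau$; afterwards, each inter-arrival time is, independently of everything else given the previous one, distributed as $\tilde\tau$ if the previous inter-arrival time exceeded $\xi$, and as $\tau$ if it was $\leq\xi$. Premium income has rate $1$, the surplus is $U(t)=x+t-\sum_{k=1}^{N(t)}Y_k$ with $N(t)$ the number of claims in $(0,t]$, and the ruin probability is $\psi(x)=\mathbb{P}(\inf\{t\geq0:U(t)<0\}<\infty)$. Standing assumption: $U(t)\to+\infty$ a.s. as $t\to\infty$ (net profit condition, $\mathbb{E}[X_1]<0$). $X_1$ is the increment of the claim surplus process $x-U(t)$ over the first regeneration cycle, i.e. from time $0$ up to the end of the first inter-arrival time exceeding $\xi$ (including the claim at its end): $$X_1\overset{d}{=}(Y_0-\tilde\tau)+\mathbf 1_{\{\tilde\tau\leq\xi\}}\Big(\sum_{k=1}^{N-1}(Y_k-\tau_k^{\leq\xi})+(Y_N-\tau_N^{>\xi})\Big),$$ where all variables are independent, $Y_k$ are copies of $Y$, $\tau_k^{\leq\xi}$, $\tau_k^{>\xi}$ have the law of $\tau$ conditioned on $\tau\leq\xi$, resp. $\tau>\xi$, and $\mathbb{P}(N=k)=(1-p)^{k-1}p$, $k\geq1$, $p=\mathbb{P}(\tau>\xi)$.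 Embedded Markov additive process $Z_n=(S_n,J_n)$, $n\geq0$, on $\mathbb{R}\times\{1,2\}$, $S_0=0$: given the past up to time $n$, if $J_n=1$ draw independent copies of $Y,\tau$ and set $S_{n+1}-S_n=Y-\tau$, $J_{n+1}=1$ if $\tau\leq\xi$ and $J_{n+1}=2$ if $\tau>\xi$; if $J_n=2$ do the same with $\tilde\tau$ in place of $\tau$. Thus, with $J_0=2$, $S_n$ is the claim surplus right after the $n$-th claim. $\mathcal F_n=\sigma(Z_0,\dots,Z_n)$, $\mathbb{P}_i$ is the law given $J_0=i$, and $$\hat{\mathbf F}[\theta]=\begin{pmatrix}\mathbb{E}[e^{\theta Y}e^{-\theta\tau};\tau\leq\xi]&\mathbb{E}[e^{\theta Y}e^{-\theta\tau};\tau>\xi]\\ \mathbb{E}[e^{\theta Y}e^{-\theta\tilde\tau};\tilde\tau\leq\xi]&\mathbb{E}[e^{\theta Y}e^{-\theta\tilde\tau};\tilde\tau>\xi]\end{pmatrix},\qquad \mathbb{E}[Z;A]=\mathbb{E}[Z\mathbf 1_A].$$ For $\kappa$ as in the claim, $1$ is the Perron–Frobenius eigenvalue of $\hat{\mathbf F}[\kappa]$. *)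

theory Defs
  imports "HOL-Probability.Probability"
begin

definition exp_law :: "real \<Rightarrow> real measure" where
  "exp_law l = density lborel (exponential_density l)"

text \<open>
  Sequences are indexed from 0: \<^term>\<open>T n\<close> is the (n+1)-st inter-arrival time and
  \<^term>\<open>Y n\<close> the (n+1)-st claim size. The two states are the elements 1 and 2 of the
  two-element type \<^typ>\<open>2\<close> (where \<^term>\<open>2 = (0 :: 2)\<close>, which differs from 1).
  State 2 means that the previous inter-arrival time exceeded \<open>\<xi>\<close>, or that there is
  none yet; \<^term>\<open>T n\<close> is drawn in state \<open>phase \<xi> T n\<close>.
\<close>

definition phase :: "real \<Rightarrow> (nat \<Rightarrow> 'a \<Rightarrow> real) \<Rightarrow> nat \<Rightarrow> 'a \<Rightarrow> 2" where
  "phase \<xi> T n \<omega> = (case n of 0 \<Rightarrow> 2 | Suc m \<Rightarrow> if T m \<omega> \<le> \<xi> then 1 else 2)"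

definition rate :: "real \<Rightarrow> real \<Rightarrow> 2 \<Rightarrow> real" where
  "rate lam1 lam2 i = (if i = 1 then lam1 else lam2)"

definition arrival_past :: "'a measure \<Rightarrow> (nat \<Rightarrow> 'a \<Rightarrow> real) \<Rightarrow> nat \<Rightarrow> 'a measure" where
  "arrival_past M T n =
     vimage_algebra (space M) (\<lambda>\<omega>. \<lambda>k\<in>{..<n}. T k \<omega>) (\<Pi>\<^sub>M k\<in>{..<n}. borel)"

locale risk_model = prob_space M for M :: "'a measure" +
  fixes Y T :: "nat \<Rightarrow> 'a \<Rightarrow> real" and \<xi> lam1 lam2 \<beta> :: real
  assumes pos: "\<xi> > 0" "lam1 > 0" "lam2 > 0" "\<beta> > 0"
    and claims_indep: "indep_vars (\<lambda>_. borel) Y UNIV"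
    and claims_law: "\<And>k. distributed M lborel (Y k) (exponential_density \<beta>)"
    and claims_arrivals_indep:
      "indep_var (\<Pi>\<^sub>M k\<in>UNIV. borel) (\<lambda>\<omega> k. Y k \<omega>) (\<Pi>\<^sub>M k\<in>UNIV. borel) (\<lambda>\<omega> k. T k \<omega>)"
    and arrivals_law:
      "\<And>n B. B \<in> sets borel \<Longrightarrow>
         AE \<omega> in M. real_cond_exp M (arrival_past M T n) (indicator {\<omega> \<in> space M. T n \<omega> \<in> B}) \<omega>
                    = measure (exp_law (rate lam1 lam2 (phase \<xi> T n \<omega>))) B"

definition arrival_time :: "(nat \<Rightarrow> 'a \<Rightarrow> real) \<Rightarrow> nat \<Rightarrow> 'a \<Rightarrow> real" where
  "arrival_time T n \<omega> = (\<Sum>k<n. T k \<omega>)"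

definition num_claims :: "(nat \<Rightarrow> 'a \<Rightarrow> real) \<Rightarrow> real \<Rightarrow> 'a \<Rightarrow> nat" where
  "num_claims T t \<omega> = card {n. 1 \<le> n \<and> arrival_time T n \<omega> \<in> {0<..t}}"

definition surplus ::
  "(nat \<Rightarrow> 'a \<Rightarrow> real) \<Rightarrow> (nat \<Rightarrow> 'a \<Rightarrow> real) \<Rightarrow> real \<Rightarrow> real \<Rightarrow> 'a \<Rightarrow> real" where
  "surplus Y T x t \<omega> = x + t - (\<Sum>k<num_claims T t \<omega>. Y k \<omega>)"

definition ruin_time ::
  "(nat \<Rightarrow> 'a \<Rightarrow> real) \<Rightarrow> (nat \<Rightarrow> 'a \<Rightarrow> real) \<Rightarrow> real \<Rightarrow> 'a \<Rightarrow> ereal" where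
  "ruin_time Y T x \<omega> = Inf (ereal ` {t. 0 \<le> t \<and> surplus Y T x t \<omega> < 0})"

definition ruin_prob ::
  "'a measure \<Rightarrow> (nat \<Rightarrow> 'a \<Rightarrow> real) \<Rightarrow> (nat \<Rightarrow> 'a \<Rightarrow> real) \<Rightarrow> real \<Rightarrow> real" where
  "ruin_prob M Y T x = measure M {\<omega> \<in> space M. ruin_time Y T x \<omega> < \<infinity>}"

text \<open>The claim surplus right after the n-th claim.\<close>

definition claim_surplus ::
  "(nat \<Rightarrow> 'a \<Rightarrow> real) \<Rightarrow> (nat \<Rightarrow> 'a \<Rightarrow> real) \<Rightarrow> nat \<Rightarrow> 'a \<Rightarrow> real" where
  "claim_surplus Y T n \<omega> = (\<Sum>k<n. Y k \<omega> - T k \<omega>)"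

text \<open>
  The first regeneration cycle ends with the claim that closes the first inter-arrival
  time exceeding \<open>\<xi>\<close>; almost surely there is such an inter-arrival time.
\<close>

definition cycle_length :: "real \<Rightarrow> (nat \<Rightarrow> 'a \<Rightarrow> real) \<Rightarrow> 'a \<Rightarrow> nat" where
  "cycle_length \<xi> T \<omega> = Inf {n. 1 \<le> n \<and> T (n - 1) \<omega> > \<xi>}"

definition cycle_increment ::
  "real \<Rightarrow> (nat \<Rightarrow> 'a \<Rightarrow> real) \<Rightarrow> (nat \<Rightarrow> 'a \<Rightarrow> real) \<Rightarrow> 'a \<Rightarrow> real" where
  "cycle_increment \<xi> Y T \<omega> = claim_surplus Y T (cycle_length \<xi> T \<omega>) \<omega>"

definition F_hat :: "real \<Rightarrow> real \<Rightarrow> real \<Rightarrow> real \<Rightarrow> real \<Rightarrow> real^2^2" where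
  "F_hat \<xi> lam1 lam2 \<beta> \<theta> = (\<chi> i j.
     \<integral>(y, t). exp (\<theta> * y) * exp (- \<theta> * t) * indicator (if j = 1 then {..\<xi>} else {\<xi><..}) t
       \<partial>(exp_law \<beta> \<Otimes>\<^sub>M exp_law (rate lam1 lam2 i)))"

text \<open>
  The embedded Markov additive process is put on its canonical path space, where a point
  \<open>z\<close> has \<open>z n = (S n, J n)\<close>: a change of measure that is prescribed only on each
  \<open>\<sigma>(Z 0, \<dots>, Z n)\<close> exists there, but need not exist on an arbitrary sample space.
\<close>

definition path_space :: "(nat \<Rightarrow> real \<times> 2) measure" where
  "path_space = (\<Pi>\<^sub>M n\<in>UNIV. borel \<Otimes>\<^sub>M count_space UNIV)"

text \<open>The law of the path when the initial state is 2.\<close>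

definition embedded_law ::
  "'a measure \<Rightarrow> real \<Rightarrow> (nat \<Rightarrow> 'a \<Rightarrow> real) \<Rightarrow> (nat \<Rightarrow> 'a \<Rightarrow> real) \<Rightarrow> (nat \<Rightarrow> real \<times> 2) measure" where
  "embedded_law M \<xi> Y T = distr M path_space (\<lambda>\<omega> n. (claim_surplus Y T n \<omega>, phase \<xi> T n \<omega>))"

definition path_filtration :: "nat \<Rightarrow> (nat \<Rightarrow> real \<times> 2) measure" where
  "path_filtration n = vimage_algebra (space path_space) (\<lambda>z. restrict z {..n})
     (\<Pi>\<^sub>M k\<in>{..n}. borel \<Otimes>\<^sub>M count_space UNIV)"

definition tilted_law ::
  "(nat \<Rightarrow> real \<times> 2) measure \<Rightarrow> real \<Rightarrow> real^2 \<Rightarrow> (nat \<Rightarrow> real \<times> 2) measure \<Rightarrow> bool" where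
  "tilted_law P \<kappa> v Q \<longleftrightarrow> sets Q = sets path_space \<and>
     (\<forall>n. restr_to_subalg Q (path_filtration n) =
        density (restr_to_subalg P (path_filtration n))
          (\<lambda>z. ennreal (exp (\<kappa> * fst (z n)) * (v $ snd (z n) / v $ snd (z 0)))))"

definition passage_time :: "real \<Rightarrow> (nat \<Rightarrow> real \<times> 2) \<Rightarrow> enat" where
  "passage_time x z = Inf (enat ` {n. fst (z n) > x})"

text \<open>
  The overshoot and the state at passage are meaningful only where the passage time is
  finite; elsewhere \<^const>\<open>the_enat\<close> gives an unspecified index.
\<close>

definition overshoot :: "real \<Rightarrow> (nat \<Rightarrow> real \<times> 2) \<Rightarrow> real" where
  "overshoot x z = fst (z (the_enat (passage_time x z))) - x"

definition passage_state :: "real \<Rightarrow> (nat \<Rightarrow> real \<times> 2) \<Rightarrow> 2" where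
  "passage_state x z = snd (z (the_enat (passage_time x z)))"

end

theory Submission
  imports Defs
begin

text \<open>
  On \<open>{T(x) = n}\<close> the change of measure turns \<open>P(T(x) = n)\<close> into a \<open>Q\<close>-expectation;
  summing over \<open>n\<close> gives the formula for \<open>P(T(x) < \<infinity>)\<close> with the expectation restricted to
  \<open>{T(x) < \<infinity>}\<close>. That \<open>Q(T(x) < \<infinity>) = 1\<close> needs no analysis of the drift under \<open>Q\<close>:
  \<open>Q(T(x) > n)\<close> is the \<open>P\<close>-expectation of the density over \<open>{T(x) > n}\<close>, where the density is
  bounded, and it tends to 0 almost surely because the net profit condition forces
  \<open>S n \<rightarrow> -\<infinity>\<close> under \<open>P\<close>. Claim arrivals do not accumulate, since a conditional
  Borel-Cantelli argument gives infinitely many inter-arrival times above \<open>\<xi>\<close>; therefore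
  ruin in continuous time is ruin at a claim.
\<close>

section \<open>Measurability of claim counts and surplus\<close>

lemma arrival_time_measurable [measurable]:
  assumes [measurable]: "\<And>k. T k \<in> borel_measurable M"
  shows "arrival_time T n \<in> borel_measurable M"
  unfolding arrival_time_def[abs_def] by measurable

lemma num_claims_measurable [measurable]:
  assumes [measurable]: "\<And>k. T k \<in> borel_measurable M" "f \<in> borel_measurable M"
  shows "(\<lambda>\<omega>. num_claims T (f \<omega>) \<omega>) \<in> measurable M (count_space UNIV)"
  unfolding num_claims_def
  by (rule measurable_card) (simp, measurable)

text \<open>The time may be random, because ruin will be tested at the arrival times. The random
  upper limit of the claim sum takes countably many values, which reduces the sum to fixed
  limits.\<close>

lemma surplus_measurable:
  assumes [measurable]: "\<And>k. Y k \<in> borel_measurable M" "\<And>k. T k \<in> borel_measurable M"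
    "f \<in> borel_measurable M"
  shows "(\<lambda>\<omega>. surplus Y T x (f \<omega>) \<omega>) \<in> borel_measurable M"
proof -
  have [measurable]: "(\<lambda>\<omega>. \<Sum>k<num_claims T (f \<omega>) \<omega>. Y k \<omega>) \<in> borel_measurable M"
    by (rule measurable_compose_countable[where f="\<lambda>n \<omega>. \<Sum>k<n. Y k \<omega>"]) measurable
  show ?thesis
    unfolding surplus_def by measurable
qed

lemma claim_surplus_measurable:
  assumes [measurable]: "\<And>k. Y k \<in> borel_measurable M" "\<And>k. T k \<in> borel_measurable M"
  shows "claim_surplus Y T n \<in> borel_measurable M"
  unfolding claim_surplus_def[abs_def] by measurable

lemma phase_measurable:
  assumes [measurable]: "\<And>k. T k \<in> borel_measurable M"
  shows "phase \<xi> T n \<in> measurable M (count_space UNIV)"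
  unfolding phase_def[abs_def] by (cases n) auto

section \<open>Pathwise reduction of ruin to the claim surplus\<close>

text \<open>
  Between two arrivals the surplus increases, so ruin can be detected at the arrival
  times. If \<^term>\<open>{n. 1 \<le> n \<and> arrival_time T n \<omega> \<in> {0<..t}}\<close> is infinite then
  \<^const>\<open>num_claims\<close> has the junk value 0, and then there is no ruin at time \<open>t\<close>.
\<close>

lemma ruin_time_finite_iff:
  assumes "x \<ge> 0"
  shows "ruin_time Y T x \<omega> < \<infinity> \<longleftrightarrow>
    (\<exists>n. 0 < arrival_time T n \<omega> \<and> surplus Y T x (arrival_time T n \<omega>) \<omega> < 0)"
    (is "_ \<longleftrightarrow> ?R")
proof -
  have "ruin_time Y T x \<omega> < \<infinity> \<longleftrightarrow> (\<exists>t\<ge>0. surplus Y T x t \<omega> < 0)"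
    unfolding ruin_time_def Inf_less_iff by auto
  also have "\<dots> \<longleftrightarrow> ?R"
  proof
    assume "\<exists>t\<ge>0. surplus Y T x t \<omega> < 0"
    then obtain t where t: "t \<ge> 0" "surplus Y T x t \<omega> < 0" by blast
    define C where "C s = {n. 1 \<le> n \<and> arrival_time T n \<omega> \<in> {0<..s}}" for s
    have num: "num_claims T s \<omega> = card (C s)" for s
      by (simp add: num_claims_def C_def)
    \<comment> \<open>With cardinality 0 no claim is subtracted and the surplus is
      \<open>x + t \<ge> 0\<close>. This excludes the empty and the infinite \<open>C t\<close> at
      once.\<close>
    have "card (C t) \<noteq> 0"
    proof
      assume "card (C t) = 0"
      with t \<open>x \<ge> 0\<close> show False by (simp add: surplus_def num)
    qed
    then have fin: "finite (C t)" and ne: "C t \<noteq> {}"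
      by (auto simp: card_eq_0_iff)
    \<comment> \<open>The latest arrival up to time \<open>t\<close>, chosen by its time and not by
      its index, so that no sign of the inter-arrival times is involved.\<close>
    obtain n where n: "n \<in> C t" and max: "\<And>m. m \<in> C t \<Longrightarrow> arrival_time T m \<omega> \<le> arrival_time T n \<omega>"
    proof -
      have "Max ((\<lambda>n. arrival_time T n \<omega>) ` C t) \<in> (\<lambda>n. arrival_time T n \<omega>) ` C t"
        using fin ne by (intro Max_in) auto
      then obtain n where "n \<in> C t" "Max ((\<lambda>n. arrival_time T n \<omega>) ` C t) = arrival_time T n \<omega>"
        by auto
      then show thesis
        using fin by (intro that[of n]) (auto intro!: Max_ge simp flip: \<open>Max _ = _\<close>)
    qed
    \<comment> \<open>The claim count at this arrival is the same as at \<open>t\<close>, while the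
      premium income is no larger, so the surplus is already negative there.\<close>
    have "C (arrival_time T n \<omega>) = C t"
      using n max by (force simp: C_def)
    then show ?R
      using t n by (intro exI[of _ n]) (auto simp: surplus_def num C_def)
  qed (use less_imp_le in blast)
  finally show ?thesis .
qed

lemma strict_mono_arrival_time:
  assumes "\<And>k. T k \<omega> > 0"
  shows "strict_mono (\<lambda>n. arrival_time T n \<omega>)"
  using assms by (intro strict_monoI_Suc) (simp add: arrival_time_def)

text \<open>Positive inter-arrival times make the arrival times strictly increasing, so exactly the
  arrivals with indices 1 to \<open>n\<close> have occurred by the \<open>n\<close>-th one.\<close>

lemma surplus_arrival_time:
  assumes "\<And>k. T k \<omega> > 0"
  shows "surplus Y T x (arrival_time T n \<omega>) \<omega> = x - claim_surplus Y T n \<omega>"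
proof -
  note mono = strict_mono_arrival_time[of T, OF assms]
  have "{m. 1 \<le> m \<and> arrival_time T m \<omega> \<in> {0<..arrival_time T n \<omega>}} = {1..n}"
    using strict_mono_less[OF mono, of 0] strict_mono_less_eq[OF mono, of _ n]
    by (auto simp: arrival_time_def[of T 0])
  then show ?thesis
    by (simp add: surplus_def num_claims_def arrival_time_def claim_surplus_def sum_subtractf)
qed

lemma ruin_time_finite_iff_claim_surplus:
  assumes "x \<ge> 0" and pos: "\<And>k. T k \<omega> > 0"
  shows "ruin_time Y T x \<omega> < \<infinity> \<longleftrightarrow> (\<exists>n. claim_surplus Y T n \<omega> > x)"
proof -
  \<comment> \<open>The claim surplus starts at 0, so it can exceed \<open>x \<ge> 0\<close> only at
    some \<open>n > 0\<close>.\<close>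
  have "0 < arrival_time T n \<omega>" if "claim_surplus Y T n \<omega> > x" for n
    using that \<open>x \<ge> 0\<close> pos
    by (cases "n = 0") (auto simp: claim_surplus_def arrival_time_def intro!: sum_pos)
  then show ?thesis
    unfolding ruin_time_finite_iff[OF \<open>x \<ge> 0\<close>] surplus_arrival_time[of T, OF pos] by auto
qed

text \<open>Each inter-arrival time above \<open>\<xi>\<close> advances the clock by more than
  \<open>\<xi>\<close>, and the others never set it back; \<open>N\<close> long ones bring it to at
  least \<open>N * \<xi>\<close>.\<close>

lemma arrival_time_at_top:
  assumes pos: "\<And>k. T k \<omega> > 0" and "\<xi> > 0" and io: "\<And>m. \<exists>j\<ge>m. T j \<omega> > \<xi>"
  shows "filterlim (\<lambda>n. arrival_time T n \<omega>) at_top sequentially"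
proof -
  note mono = strict_mono_mono[OF strict_mono_arrival_time[of T, OF pos]]
  have *: "\<exists>n. real N * \<xi> \<le> arrival_time T n \<omega>" for N
  proof (induction N)
    case 0
    then show ?case
      by (intro exI[of _ 0]) (simp add: arrival_time_def)
  next
    case (Suc N)
    then obtain n where n: "real N * \<xi> \<le> arrival_time T n \<omega>" by blast
    obtain j where j: "j \<ge> n" "T j \<omega> > \<xi>" using io by blast
    have "arrival_time T (Suc j) \<omega> = arrival_time T j \<omega> + T j \<omega>"
      by (simp add: arrival_time_def)
    with n j monoD[OF mono j(1)] show ?case
      by (intro exI[of _ "Suc j"]) (simp add: algebra_simps)
  qed
  show ?thesis
    unfolding filterlim_at_top
  proof
    fix Z :: real
    obtain N where "Z < real N * \<xi>"
      using ex_less_of_nat_mult[OF \<open>\<xi> > 0\<close>] by blast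
    then obtain n where "Z \<le> arrival_time T n \<omega>"
      using *[of N] by (meson less_imp_le order_trans)
    then show "\<forall>\<^sub>F n in sequentially. Z \<le> arrival_time T n \<omega>"
      unfolding eventually_sequentially using monoD[OF mono] order_trans by blast
  qed
qed

text \<open>The surplus, sampled along the arrival times, is \<open>x\<close> minus the claim
  surplus; since these times tend to infinity, its divergence passes to the sequence.\<close>

lemma claim_surplus_at_bot:
  assumes pos: "\<And>k. T k \<omega> > 0" and "\<xi> > 0" and io: "\<And>m. \<exists>j\<ge>m. T j \<omega> > \<xi>"
    and "filterlim (\<lambda>t. surplus Y T x t \<omega>) at_top at_top"
  shows "filterlim (\<lambda>n. claim_surplus Y T n \<omega>) at_bot sequentially"
proof -
  have "filterlim (\<lambda>n. x - claim_surplus Y T n \<omega>) at_top sequentially"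
    using filterlim_compose[OF assms(4) arrival_time_at_top[of T, OF assms(1-3)]]
    by (simp add: surplus_arrival_time[of T, OF pos])
  then have "filterlim (\<lambda>n. - x + (x - claim_surplus Y T n \<omega>)) at_top sequentially"
    by (intro filterlim_tendsto_add_at_top[OF tendsto_const])
  then show ?thesis
    by (simp add: filterlim_uminus_at_bot)
qed

section \<open>Inter-arrival times under their conditional law\<close>

lemma measure_exp_law_atMost:
  assumes "l > 0" "a \<ge> 0"
  shows "measure (exp_law l) {..a} = 1 - exp (- a * l)"
proof -
  interpret D: prob_space "exp_law l"
    unfolding exp_law_def using assms(1) by (rule prob_space_exponential_density)
  \<comment> \<open>The identity is an exponential variable on the space \<open>exp_law l\<close>,
    so the known distribution function applies.\<close>
  have "distributed (exp_law l) lborel (\<lambda>x. x) (exponential_density l)"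
    by (auto simp: distributed_def exp_law_def distr_id2 sets_distr intro!: measurable_ident_sets)
  from D.exponential_distributedD_le[OF this assms(2,1)] show ?thesis
    by (simp add: exp_law_def atMost_def)
qed

context risk_model
begin

text \<open>Measurability is contained in the independence of claims and arrivals, which are random
  elements of the sequence space.\<close>

lemma T_measurable [measurable]: "T k \<in> borel_measurable M"
  using measurable_compose[OF indep_var_rv2[OF claims_arrivals_indep] measurable_component_singleton[of k]]
  by simp

lemma Y_measurable [measurable]: "Y k \<in> borel_measurable M"
  using measurable_compose[OF indep_var_rv1[OF claims_arrivals_indep] measurable_component_singleton[of k]]
  by simp

lemma subalgebra_arrival_past: "subalgebra M (arrival_past M T n)"
proof -
  have "(\<lambda>\<omega>. \<lambda>k\<in>{..<n}. T k \<omega>) \<in> measurable M (\<Pi>\<^sub>M k\<in>{..<n}. borel)"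
    by measurable
  then show ?thesis
    by (simp add: subalgebra_def arrival_past_def sets_image_in_sets)
qed

lemma space_arrival_past [simp]: "space (arrival_past M T n) = space M"
  by (simp add: arrival_past_def)

lemma T_measurable_arrival_past:
  assumes "k < n"
  shows "T k \<in> borel_measurable (arrival_past M T n)"
proof -
  have "(\<lambda>\<omega>. \<lambda>k\<in>{..<n}. T k \<omega>) \<in> measurable (arrival_past M T n) (\<Pi>\<^sub>M k\<in>{..<n}. borel)"
    unfolding arrival_past_def by (rule measurable_vimage_algebra1) (auto simp: space_PiM)
  from measurable_compose[OF this measurable_component_singleton[of k]] assms show ?thesis
    by simp
qed

text \<open>Whatever the state, the conditional probability of \<open>B\<close> is at most
  \<open>q\<close>; integrating it over an event \<open>A\<close> of the past gives the bound. The
  conditional law of the arrivals enters the proof only here.\<close>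

lemma prob_arrival_le:
  assumes A: "A \<in> sets (arrival_past M T n)" and B: "B \<in> sets borel"
    and q: "\<And>i. measure (exp_law (rate lam1 lam2 i)) B \<le> q"
  shows "prob {\<omega> \<in> A. T n \<omega> \<in> B} \<le> q * prob A"
proof -
  interpret F: finite_measure_subalgebra M "arrival_past M T n"
    by unfold_locales (rule subalgebra_arrival_past)
  define D where "D = {\<omega> \<in> space M. T n \<omega> \<in> B}"
  have D [measurable]: "D \<in> sets M" unfolding D_def using B by measurable
  have AM [measurable]: "A \<in> sets M" using A subalgebra_arrival_past by (auto simp: subalgebra_def)
  have int: "integrable M (indicator D :: 'a \<Rightarrow> real)"
    by (simp add: less_top[symmetric])
  have "{\<omega> \<in> A. T n \<omega> \<in> B} = D \<inter> A"
    using sets.sets_into_space[OF AM] by (auto simp: D_def)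
  then have "prob {\<omega> \<in> A. T n \<omega> \<in> B} = (\<integral>\<omega>\<in>A. indicator D \<omega> \<partial>M)"
    by (simp add: set_lebesgue_integral_def indicator_inter_arith[symmetric] Int_commute)
  also have "\<dots> = (\<integral>\<omega>\<in>A. real_cond_exp M (arrival_past M T n) (indicator D) \<omega> \<partial>M)"
    by (rule F.real_cond_exp_intA[OF int A])
  also have "\<dots> \<le> (\<integral>\<omega>\<in>A. q \<partial>M)"
  proof -
    have "integrable M (real_cond_exp M (arrival_past M T n) (indicator D))"
      using F.real_cond_exp_int(1)[OF int] .
    then show ?thesis
      unfolding set_lebesgue_integral_def
      using arrivals_law[OF B, of n] q
      by (intro integral_mono_AE integrable_mult_indicator)
         (auto simp: D_def[symmetric] elim!: eventually_mono intro!: mult_left_mono)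
  qed
  also have "\<dots> = q * prob A"
    by (simp add: set_lebesgue_integral_def)
  finally show ?thesis .
qed

lemma rate_pos: "rate lam1 lam2 i > 0"
  using pos by (simp add: rate_def)

lemma AE_arrival_pos: "AE \<omega> in M. \<forall>k. T k \<omega> > 0"
  unfolding AE_all_countable
proof
  fix k
  \<comment> \<open>The whole space belongs to every past, and \<open>q = 0\<close> is admissible
    since neither exponential law charges \<open>{..0}\<close>.\<close>
  have "prob {\<omega> \<in> space M. T k \<omega> \<in> {..0}} \<le> 0 * prob (space M)"
    using sets.top[of "arrival_past M T k"]
    by (intro prob_arrival_le) (auto simp: measure_exp_law_atMost rate_pos)
  then have "prob {\<omega> \<in> space M. \<not> T k \<omega> > 0} = 0"
    by (simp add: not_less measure_le_0_iff)
  then show "AE \<omega> in M. T k \<omega> > 0"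
    by (subst AE_iff_measurable[OF _ refl]) (simp_all add: emeasure_eq_measure)
qed

text \<open>A run of \<open>k\<close> inter-arrival times not exceeding \<open>\<xi>\<close> has
  probability at most \<open>q ^ k\<close> with \<open>q < 1\<close>, wherever it starts; an
  infinite run therefore has probability 0.\<close>

lemma AE_arrival_gt_infinitely_often: "AE \<omega> in M. \<forall>m. \<exists>j\<ge>m. T j \<omega> > \<xi>"
  unfolding AE_all_countable
proof
  fix m
  \<comment> \<open>The larger of the two probabilities of not exceeding \<open>\<xi>\<close>; it
    belongs to the larger rate and bounds both states.\<close>
  define q where "q = 1 - exp (- \<xi> * max lam1 lam2)"
  have q: "measure (exp_law (rate lam1 lam2 i)) {..\<xi>} \<le> q" for i
    using pos by (auto simp: measure_exp_law_atMost rate_pos q_def rate_def)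
  have q01: "0 \<le> q" "q < 1"
    using pos by (auto simp: q_def)
  \<comment> \<open>Decided by the inter-arrival times with index below \<open>m + k\<close>, so
    \<open>prob_arrival_le\<close> applies to the one with index \<open>m + k\<close>.\<close>
  define A where "A k = {\<omega> \<in> space M. \<forall>j\<in>{m..<m+k}. T j \<omega> \<le> \<xi>}" for k
  have A_past: "A k \<in> sets (arrival_past M T (m + k))" for k
  proof -
    have [measurable]: "T j \<in> borel_measurable (arrival_past M T (m + k))" if "j \<in> {m..<m+k}" for j
      using that by (intro T_measurable_arrival_past) auto
    have "{\<omega> \<in> space (arrival_past M T (m + k)). \<forall>j\<in>{m..<m+k}. T j \<omega> \<le> \<xi>}
        \<in> sets (arrival_past M T (m + k))"
      by (intro sets.sets_Collect_finite_All) measurable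
    then show ?thesis
      by (simp add: A_def)
  qed
  have A_le: "prob (A k) \<le> q ^ k" for k
  proof (induction k)
    case (Suc k)
    have "A (Suc k) = {\<omega> \<in> A k. T (m + k) \<omega> \<in> {..\<xi>}}"
      by (auto simp: A_def less_Suc_eq)
    then have "prob (A (Suc k)) \<le> q * prob (A k)"
      using prob_arrival_le[OF A_past _ q] by simp
    also have "\<dots> \<le> q * q ^ k"
      using Suc q01 by (intro mult_left_mono) auto
    finally show ?case by simp
  qed simp
  define E where "E = {\<omega> \<in> space M. \<not> (\<exists>j\<ge>m. T j \<omega> > \<xi>)}"
  have "prob E \<le> q ^ k" for k
  proof -
    have "A k \<in> sets M"
      using A_past subalgebra_arrival_past by (auto simp: subalgebra_def)
    then have "prob E \<le> prob (A k)"
      by (intro finite_measure_mono) (auto simp: E_def A_def not_less)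
    with A_le[of k] show ?thesis by simp
  qed
  then have "prob E \<le> 0"
    using q01 by (intro LIMSEQ_le_const[OF LIMSEQ_power_zero[of q]]) auto
  then have "prob E = 0"
    by (simp add: measure_le_0_iff)
  then show "AE \<omega> in M. \<exists>j\<ge>m. T j \<omega> > \<xi>"
    by (subst AE_iff_measurable[OF _ E_def[symmetric]]) (simp_all add: emeasure_eq_measure E_def)
qed

section \<open>Ruin probability and drift in terms of the claim surplus\<close>

lemma ruin_prob_eq_claim_surplus:
  assumes "x \<ge> 0"
  shows "ruin_prob M Y T x = prob {\<omega> \<in> space M. \<exists>n. claim_surplus Y T n \<omega> > x}"
  unfolding ruin_prob_def
proof (rule finite_measure_eq_AE)
  have [measurable]: "(\<lambda>\<omega>. surplus Y T x (arrival_time T n \<omega>) \<omega>) \<in> borel_measurable M" for n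
    by (rule surplus_measurable) measurable
  \<comment> \<open>The test at arrival times is valid on every path and replaces a continuum of
    times by a countable union.\<close>
  show "{\<omega> \<in> space M. ruin_time Y T x \<omega> < \<infinity>} \<in> sets M"
    unfolding ruin_time_finite_iff[OF assms] by measurable
  have [measurable]: "claim_surplus Y T n \<in> borel_measurable M" for n
    by (rule claim_surplus_measurable) measurable
  show "{\<omega> \<in> space M. \<exists>n. claim_surplus Y T n \<omega> > x} \<in> sets M"
    by measurable
  show "AE \<omega> in M. (\<omega> \<in> {\<omega> \<in> space M. ruin_time Y T x \<omega> < \<infinity>}) =
      (\<omega> \<in> {\<omega> \<in> space M. \<exists>n. claim_surplus Y T n \<omega> > x})"
    using AE_arrival_pos ruin_time_finite_iff_claim_surplus[OF assms, where T=T]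
    by (auto elim!: eventually_mono)
qed

lemma AE_claim_surplus_at_bot:
  assumes "AE \<omega> in M. filterlim (\<lambda>t. surplus Y T x t \<omega>) at_top at_top"
  shows "AE \<omega> in M. filterlim (\<lambda>n. claim_surplus Y T n \<omega>) at_bot sequentially"
  using assms AE_arrival_pos AE_arrival_gt_infinitely_often
proof eventually_elim
  case (elim \<omega>)
  then show ?case
    using pos(1) by (intro claim_surplus_at_bot) auto
qed

lemma path_measurable:
  "(\<lambda>\<omega> n. (claim_surplus Y T n \<omega>, phase \<xi> T n \<omega>)) \<in> measurable M path_space"
proof -
  have [measurable]: "claim_surplus Y T n \<in> borel_measurable M"
    "phase \<xi> T n \<in> measurable M (count_space UNIV)" for n
    by (auto intro!: claim_surplus_measurable phase_measurable)
  show ?thesis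
    unfolding path_space_def by (rule measurable_PiM_single') (auto simp: space_pair_measure)
qed

end

section \<open>Path space, its filtration and the first passage\<close>

lemma space_path_space [simp]: "space path_space = UNIV"
  by (auto simp: path_space_def space_PiM space_pair_measure)

lemma subalgebra_path_filtration:
  assumes "sets N = sets path_space"
  shows "subalgebra N (path_filtration n)"
proof -
  have "(\<lambda>z. restrict z {..n}) \<in> measurable path_space (\<Pi>\<^sub>M k\<in>{..n}. borel \<Otimes>\<^sub>M count_space UNIV)"
    unfolding path_space_def by (rule measurable_restrict_subset) simp
  then show ?thesis
    using assms sets_eq_imp_space_eq[OF assms]
    by (simp add: subalgebra_def path_filtration_def sets_image_in_sets)
qed

lemma component_measurable_path_filtration:
  assumes "k \<le> n"
  shows "(\<lambda>z. z k) \<in> measurable (path_filtration n) (borel \<Otimes>\<^sub>M count_space UNIV)"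
proof -
  have "(\<lambda>z. restrict z {..n}) \<in>
      measurable (path_filtration n) (\<Pi>\<^sub>M k\<in>{..n}. borel \<Otimes>\<^sub>M count_space UNIV)"
    unfolding path_filtration_def
    by (rule measurable_vimage_algebra1) (auto simp: space_PiM space_pair_measure)
  from measurable_compose[OF this measurable_component_singleton[of k]] assms show ?thesis
    by simp
qed

lemma fst_measurable_path_filtration:
  "k \<le> n \<Longrightarrow> (\<lambda>z. fst (z k)) \<in> borel_measurable (path_filtration n)"
  using measurable_compose[OF component_measurable_path_filtration measurable_fst] .

lemma space_path_filtration [simp]: "space (path_filtration n) = UNIV"
  by (simp add: path_filtration_def)

lemma level_sets_path_filtration:
  assumes "k \<le> n"
  shows "{z. fst (z k) \<le> x} \<in> sets (path_filtration n)"
    and "{z. x < fst (z k)} \<in> sets (path_filtration n)"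
proof -
  note [measurable] = fst_measurable_path_filtration[OF assms]
  have "{z \<in> space (path_filtration n). fst (z k) \<le> x} \<in> sets (path_filtration n)"
    "{z \<in> space (path_filtration n). x < fst (z k)} \<in> sets (path_filtration n)"
    by measurable
  then show "{z. fst (z k) \<le> x} \<in> sets (path_filtration n)"
    "{z. x < fst (z k)} \<in> sets (path_filtration n)"
    by simp_all
qed

lemma component_measurable_path_space:
  "(\<lambda>z. z k) \<in> measurable path_space (borel \<Otimes>\<^sub>M count_space UNIV)"
  unfolding path_space_def by measurable

lemma passage_time_finite_iff: "passage_time x z < \<infinity> \<longleftrightarrow> (\<exists>n. fst (z n) > x)"
  unfolding passage_time_def Inf_less_iff by auto

text \<open>The infimum is rewritten as a least natural number, a form in which measurability of the
  passage index can be derived.\<close>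

lemma passage_time_eq:
  "passage_time x z = (if \<exists>n. fst (z n) > x then enat (LEAST n. fst (z n) > x) else \<infinity>)"
proof (cases "\<exists>n. fst (z n) > x")
  case True
  then have "x < fst (z (LEAST n. x < fst (z n)))"
    by (rule LeastI_ex)
  then have "Inf (enat ` {n. x < fst (z n)}) = enat (LEAST n. x < fst (z n))"
    by (intro cInf_eq_minimum) (auto intro: Least_le)
  with True show ?thesis
    by (simp add: passage_time_def)
qed (auto simp: passage_time_def top_enat_def)

lemma passage_time_eq_enat:
  assumes "fst (z n) > x" "\<And>k. k < n \<Longrightarrow> fst (z k) \<le> x"
  shows "passage_time x z = enat n"
proof -
  have "(LEAST n. fst (z n) > x) = n"
    using assms by (intro Least_equality) (auto simp: not_less[symmetric])
  with assms show ?thesis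
    by (auto simp: passage_time_eq)
qed

lemma at_passage_measurable:
  "(\<lambda>z. z (the_enat (passage_time x z))) \<in> measurable path_space (borel \<Otimes>\<^sub>M count_space UNIV)"
proof -
  note [measurable] = component_measurable_path_space
  \<comment> \<open>All paths that never exceed \<open>x\<close> receive the same index
    \<open>the_enat \<infinity>\<close>, so measurability holds there too.\<close>
  have "(\<lambda>z. the_enat (passage_time x z)) \<in> measurable path_space (count_space UNIV)"
    unfolding passage_time_eq if_distrib by measurable
  then show ?thesis
    by (rule measurable_compose_countable[where f="\<lambda>n z. z n",
          OF component_measurable_path_space])
qed

text \<open>The state carries the discrete sigma-algebra, so every function of it is
  measurable.\<close>

lemma measurable_vec_nth_snd:
  assumes "f \<in> measurable N (borel \<Otimes>\<^sub>M count_space UNIV)"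
  shows "(\<lambda>z. (v :: real^'n) $ snd (f z)) \<in> borel_measurable N"
  by (rule measurable_compose[OF measurable_compose[OF assms measurable_snd]]) simp

lemma measurable_overshoot_state:
  "(\<lambda>z. exp (- \<kappa> * overshoot x z) / (v :: real^2) $ passage_state x z) \<in> borel_measurable path_space"
proof -
  note [measurable] = at_passage_measurable measurable_vec_nth_snd[OF at_passage_measurable]
  show ?thesis
    unfolding overshoot_def passage_state_def by measurable
qed

section \<open>Change of measure up to a fixed index\<close>

lemma sets_tilted_law: "tilted_law P \<kappa> v Q \<Longrightarrow> sets Q = sets path_space"
  by (simp add: tilted_law_def)

text \<open>The density is prescribed only on the sigma-algebra of the first \<open>n\<close> steps,
  so the integral of a \<open>g\<close> measurable there is moved to the restricted measure,
  reweighted, and moved back.\<close>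

lemma nn_integral_tilted_law:
  assumes "tilted_law P \<kappa> v Q" and P: "sets P = sets path_space"
    and g: "g \<in> borel_measurable (path_filtration n)"
  shows "(\<integral>\<^sup>+z. g z \<partial>Q) =
    (\<integral>\<^sup>+z. ennreal (exp (\<kappa> * fst (z n)) * (v $ snd (z n) / v $ snd (z 0))) * g z \<partial>P)"
proof -
  have Q: "sets Q = sets path_space"
    and dens: "restr_to_subalg Q (path_filtration n) =
        density (restr_to_subalg P (path_filtration n))
          (\<lambda>z. ennreal (exp (\<kappa> * fst (z n)) * (v $ snd (z n) / v $ snd (z 0))))"
    using assms by (auto simp: tilted_law_def)
  note [measurable] = component_measurable_path_filtration[OF le0]
    component_measurable_path_filtration[OF order_refl] g
    measurable_vec_nth_snd[OF component_measurable_path_filtration[OF le0]]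
    measurable_vec_nth_snd[OF component_measurable_path_filtration[OF order_refl]]
  note sP = subalgebra_path_filtration[OF P, of n]
  note sQ = subalgebra_path_filtration[OF Q, of n]
  have m: "measurable (restr_to_subalg P (path_filtration n)) borel = measurable (path_filtration n) borel"
    by (intro measurable_cong_sets sets_restr_to_subalg[OF sP]) simp
  have "(\<integral>\<^sup>+z. g z \<partial>Q) = (\<integral>\<^sup>+z. g z \<partial>restr_to_subalg Q (path_filtration n))"
    by (rule nn_integral_subalgebra2[OF sQ g, symmetric])
  also have "\<dots> = (\<integral>\<^sup>+z. ennreal (exp (\<kappa> * fst (z n)) * (v $ snd (z n) / v $ snd (z 0))) * g z
      \<partial>restr_to_subalg P (path_filtration n))"
    unfolding dens by (rule nn_integral_density) (unfold m, measurable)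
  also have "\<dots> = (\<integral>\<^sup>+z. ennreal (exp (\<kappa> * fst (z n)) * (v $ snd (z n) / v $ snd (z 0))) * g z \<partial>P)"
    by (rule nn_integral_subalgebra2[OF sP]) measurable
  finally show ?thesis .
qed

section \<open>First passage under the tilted law\<close>

context
  fixes P Q :: "(nat \<Rightarrow> real \<times> 2) measure" and \<kappa> :: real and v :: "real^2"
  assumes tilted: "tilted_law P \<kappa> v Q" and sets_P: "sets P = sets path_space"
    and v_pos: "\<And>i. v $ i > 0"
begin

lemma sets_path_filtration:
  assumes "A \<in> sets (path_filtration n)"
  shows "A \<in> sets path_space" "A \<in> sets Q" "A \<in> sets P"
  using assms subalgebra_path_filtration[OF refl, of n] sets_tilted_law[OF tilted] sets_P
  by (auto simp: subalgebra_def)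

text \<open>Dominated convergence under \<open>P\<close>, applied to the density cut off to the
  event \<open>B n\<close> that no passage occurs up to \<open>n\<close>.\<close>

lemma AE_passage_time_finite:
  assumes "finite_measure P" and "\<kappa> > 0"
    and lim: "AE z in P. filterlim (\<lambda>n. fst (z n)) at_bot sequentially"
  shows "AE z in Q. passage_time x z < \<infinity>"
proof -
  interpret P: finite_measure P by fact
  define B where "B n = {z :: nat \<Rightarrow> real \<times> 2. \<forall>k\<le>n. fst (z k) \<le> x}" for n
  have B_F: "B n \<in> sets (path_filtration n)" for n
  proof -
    have "{z \<in> space (path_filtration n). \<forall>k\<in>{..n}. fst (z k) \<le> x} \<in> sets (path_filtration n)"
      by (intro sets.sets_Collect_finite_All) (auto intro!: level_sets_path_filtration)
    then show ?thesis by (simp add: B_def Ball_def)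
  qed
  \<comment> \<open>Bounds every ratio of two entries of \<open>v\<close>, hence the eigenvector
    factor of the density.\<close>
  define K where "K = max (v $ 1) (v $ 2) / min (v $ 1) (v $ 2)"
  have K: "v $ i / v $ j \<le> K" for i j
    unfolding K_def using v_pos exhaust_2[of i] exhaust_2[of j]
    by (intro frac_le) (auto simp: less_imp_le le_max_iff_disj)
  have K0: "K \<ge> 0" using K[of 1 1] v_pos[of 1] by simp
  define h where "h n z = exp (\<kappa> * fst (z n)) * (v $ snd (z n) / v $ snd (z 0)) * indicator (B n) z" for n z
  have h_nonneg: "0 \<le> h n z" for n z
    using v_pos unfolding h_def by (intro mult_nonneg_nonneg divide_nonneg_nonneg) (auto intro: less_imp_le)
  have h_le: "h n z \<le> exp (\<kappa> * fst (z n)) * K" for n z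
  proof -
    have "h n z \<le> exp (\<kappa> * fst (z n)) * (v $ snd (z n) / v $ snd (z 0))"
      unfolding h_def using v_pos
      by (intro mult_right_le_one_le mult_nonneg_nonneg divide_nonneg_nonneg) (auto intro: less_imp_le)
    also have "\<dots> \<le> exp (\<kappa> * fst (z n)) * K"
      using K by (intro mult_left_mono) auto
    finally show ?thesis .
  qed
  \<comment> \<open>On \<open>B n\<close> the exponent is at most \<open>\<kappa> * x\<close>, and
    off \<open>B n\<close> the function vanishes; the constant is integrable since \<open>P\<close>
    is finite.\<close>
  have h_bound: "h n z \<le> exp (\<kappa> * x) * K" for n z
  proof (cases "z \<in> B n")
    case True
    then have "exp (\<kappa> * fst (z n)) \<le> exp (\<kappa> * x)"
      using \<open>\<kappa> > 0\<close> by (simp add: B_def)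
    with h_le[of n z] K0 show ?thesis
      by (meson mult_right_mono order_trans)
  next
    case False
    then have "h n z = 0" by (simp add: h_def)
    with K0 show ?thesis by simp
  qed
  have [measurable]: "h n \<in> borel_measurable P" for n
  proof -
    note [measurable] = component_measurable_path_space sets_path_filtration(1)[OF B_F]
      measurable_vec_nth_snd[OF component_measurable_path_space]
    have "h n \<in> borel_measurable path_space"
      unfolding h_def[abs_def] by measurable
    then show ?thesis
      by (simp add: measurable_cong_sets[OF sets_P refl])
  qed
  have emeasure_B: "emeasure Q (B n) = (\<integral>\<^sup>+z. ennreal (h n z) \<partial>P)" for n
  proof -
    have "emeasure Q (B n) = (\<integral>\<^sup>+z. indicator (B n) z \<partial>Q)"
      using sets_path_filtration(2)[OF B_F] by simp
    also have "\<dots> = (\<integral>\<^sup>+z. ennreal (exp (\<kappa> * fst (z n)) * (v $ snd (z n) / v $ snd (z 0))) * indicator (B n) z \<partial>P)"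
      by (rule nn_integral_tilted_law[OF tilted sets_P]) (use B_F in simp)
    also have "\<dots> = (\<integral>\<^sup>+z. ennreal (h n z) \<partial>P)"
      by (intro nn_integral_cong) (auto simp: h_def indicator_def)
    finally show ?thesis .
  qed
  \<comment> \<open>Squeezed between 0 and \<open>exp (\<kappa> * fst (z n)) * K\<close>, which
    tends to 0 because the path drifts to minus infinity.\<close>
  have "AE z in P. (\<lambda>n. h n z) \<longlonglongrightarrow> 0"
    using lim
  proof eventually_elim
    case (elim z)
    have "filterlim (\<lambda>n. \<kappa> * fst (z n)) at_bot sequentially"
      using elim \<open>\<kappa> > 0\<close> by (simp add: filterlim_tendsto_pos_mult_at_bot[OF tendsto_const])
    then have "(\<lambda>n. exp (\<kappa> * fst (z n)) * K) \<longlonglongrightarrow> 0"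
      by (intro tendsto_mult_left_zero filterlim_compose[OF exp_at_bot])
    then show ?case
      by (rule tendsto_sandwich[OF _ _ tendsto_const, rotated 2])
         (intro always_eventually allI h_le h_nonneg)+
  qed
  then have "(\<lambda>n. \<integral>\<^sup>+z. ennreal (h n z) \<partial>P) \<longlonglongrightarrow> (\<integral>\<^sup>+z. 0 \<partial>P)"
    using h_bound
    by (intro nn_integral_dominated_convergence[where w="\<lambda>_. ennreal (exp (\<kappa> * x) * K)"])
       (auto simp: P.emeasure_eq_measure ennreal_mult_less_top intro!: ennreal_leI elim!: eventually_mono dest!: tendsto_ennrealI)
  then have "(\<lambda>n. emeasure Q (B n)) \<longlonglongrightarrow> 0"
    by (simp add: emeasure_B)
  moreover have "emeasure Q {z. \<not> passage_time x z < \<infinity>} \<le> emeasure Q (B n)" for n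
    using sets_path_filtration(2)[OF B_F] unfolding passage_time_finite_iff
    by (intro emeasure_mono) (auto simp: B_def not_less)
  ultimately have "emeasure Q {z. \<not> passage_time x z < \<infinity>} \<le> 0"
    by (intro LIMSEQ_le_const) auto
  moreover have "{z. \<not> passage_time x z < \<infinity>} \<in> sets Q"
  proof -
    note [measurable] = component_measurable_path_space
    have "{z \<in> space path_space. \<not> (\<exists>n. fst (z n) > x)} \<in> sets path_space"
      by measurable
    then show ?thesis
      by (simp only: sets_tilted_law[OF tilted] passage_time_finite_iff space_path_space) simp
  qed
  ultimately show ?thesis
    by (subst AE_iff_measurable[OF _ refl]) (simp_all add: sets_eq_imp_space_eq[OF sets_tilted_law[OF tilted]])
qed

text \<open>When passage occurs at \<open>n\<close>, the integrand cancels the factor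
  \<open>v $ snd (z n)\<close> of the density and reduces its exponential to
  \<open>exp (\<kappa> * x)\<close>. Only the constant \<open>exp (\<kappa> * x) / v $ i\<close>
  remains, and summation over \<open>n\<close> yields the probability of passage.\<close>

lemma nn_integral_overshoot:
  assumes fin: "AE z in Q. passage_time x z < \<infinity>"
    and initial: "AE z in P. snd (z 0) = i"
  shows "(\<integral>\<^sup>+z. ennreal (exp (- \<kappa> * overshoot x z) / v $ passage_state x z) \<partial>Q) =
    ennreal (exp (\<kappa> * x) / v $ i) * emeasure P {z. \<exists>n. fst (z n) > x}"
proof -
  define A where "A n = {z :: nat \<Rightarrow> real \<times> 2. fst (z n) > x \<and> (\<forall>k<n. fst (z k) \<le> x)}" for n
  define f where "f z = exp (- \<kappa> * overshoot x z) / v $ passage_state x z" for z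
  define d where "d = exp (\<kappa> * x) / v $ i"
  have A_F: "A n \<in> sets (path_filtration n)" for n
  proof -
    have "{z \<in> space (path_filtration n). fst (z n) > x} \<inter>
        {z \<in> space (path_filtration n). \<forall>k\<in>{..<n}. fst (z k) \<le> x} \<in> sets (path_filtration n)"
      by (intro sets.Int sets.sets_Collect_finite_All) (auto intro!: level_sets_path_filtration)
    moreover have "A n = {z \<in> space (path_filtration n). fst (z n) > x} \<inter>
        {z \<in> space (path_filtration n). \<forall>k\<in>{..<n}. fst (z k) \<le> x}"
      by (auto simp: A_def)
    ultimately show ?thesis by simp
  qed
  have disj: "disjoint_family A"
    unfolding disjoint_family_on_def A_def
    by (auto simp: not_less[symmetric]) (metis linorder_neqE_nat)
  have Un_A: "(\<Union>n. A n) = {z. \<exists>n. fst (z n) > x}"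
  proof safe
    fix z :: "nat \<Rightarrow> real \<times> 2" and n assume "x < fst (z n)"
    then have "z \<in> A (LEAST n. x < fst (z n))"
      unfolding A_def by (auto intro: LeastI dest: not_less_Least)
    then show "z \<in> (\<Union>n. A n)" by blast
  qed (auto simp: A_def)
  have f [measurable]: "f \<in> borel_measurable Q"
    unfolding f_def[abs_def]
    by (rule measurable_overshoot_state[unfolded measurable_cong_sets[OF sets_tilted_law[OF tilted, symmetric] refl]])
  have part: "(\<integral>\<^sup>+z. ennreal (f z) * indicator (A n) z \<partial>Q) = ennreal d * emeasure P (A n)" for n
  proof -
    \<comment> \<open>The random passage index is replaced by \<open>n\<close>; this agrees with the
      integrand on \<open>A n\<close> and is determined by the first \<open>n\<close> steps.\<close>
    define g where "g z = ennreal (exp (- \<kappa> * (fst (z n) - x)) / v $ snd (z n)) * indicator (A n) z"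
      for z :: "nat \<Rightarrow> real \<times> 2"
    have g: "g \<in> borel_measurable (path_filtration n)"
    proof -
      note [measurable] = component_measurable_path_filtration[OF order_refl] A_F[of n]
        measurable_vec_nth_snd[OF component_measurable_path_filtration[OF order_refl]]
      show ?thesis unfolding g_def[abs_def] by measurable
    qed
    have "ennreal (f z) * indicator (A n) z = g z" for z
    proof (cases "z \<in> A n")
      case True
      then have "passage_time x z = enat n"
        by (intro passage_time_eq_enat) (auto simp: A_def)
      then show ?thesis
        by (simp add: f_def g_def overshoot_def passage_state_def)
    qed (simp add: g_def)
    then have "(\<integral>\<^sup>+z. ennreal (f z) * indicator (A n) z \<partial>Q) = (\<integral>\<^sup>+z. g z \<partial>Q)"
      by simp
    also have "\<dots> = (\<integral>\<^sup>+z. ennreal (exp (\<kappa> * fst (z n)) * (v $ snd (z n) / v $ snd (z 0))) * g z \<partial>P)"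
      by (rule nn_integral_tilted_law[OF tilted sets_P g])
    also have "\<dots> = (\<integral>\<^sup>+z. ennreal d * indicator (A n) z \<partial>P)"
    proof (rule nn_integral_cong_AE)
      show "AE z in P. ennreal (exp (\<kappa> * fst (z n)) * (v $ snd (z n) / v $ snd (z 0))) * g z =
          ennreal d * indicator (A n) z"
        using initial
      proof eventually_elim
        case (elim z)
        let ?w = "exp (\<kappa> * fst (z n)) * (v $ snd (z n) / v $ snd (z 0))"
        have "?w * (exp (- \<kappa> * (fst (z n) - x)) / v $ snd (z n))
            = exp (\<kappa> * fst (z n)) * exp (- \<kappa> * (fst (z n) - x)) / v $ i"
          using v_pos[of "snd (z n)"] elim by simp
        also have "\<dots> = d"
          by (simp add: d_def flip: exp_add) (simp add: algebra_simps)
        finally have eq: "?w * (exp (- \<kappa> * (fst (z n) - x)) / v $ snd (z n)) = d" .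
        have "0 \<le> ?w"
          using v_pos[of "snd (z n)"] v_pos[of "snd (z 0)"] by simp
        then show ?case
          using v_pos[of "snd (z n)"] unfolding eq[symmetric]
          by (subst ennreal_mult) (auto simp: g_def mult.assoc)
      qed
    qed
    also have "\<dots> = ennreal d * emeasure P (A n)"
      by (intro nn_integral_cmult_indicator sets_path_filtration(3)[OF A_F])
    finally show ?thesis .
  qed
  \<comment> \<open>The disjoint events \<open>A n\<close> exhaust \<open>Q\<close>-almost every
    path; this is where finiteness of the passage time under \<open>Q\<close> is used.\<close>
  have "(\<integral>\<^sup>+z. ennreal (f z) \<partial>Q) = (\<integral>\<^sup>+z. (\<Sum>n. ennreal (f z) * indicator (A n) z) \<partial>Q)"
  proof (rule nn_integral_cong_AE)
    show "AE z in Q. ennreal (f z) = (\<Sum>n. ennreal (f z) * indicator (A n) z)"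
      using fin
    proof eventually_elim
      case (elim z)
      then have "z \<in> (\<Union>n. A n)"
        unfolding Un_A passage_time_finite_iff by simp
      then show ?case
        by (simp add: ennreal_suminf_cmult suminf_indicator[OF disj])
    qed
  qed
  also have "\<dots> = (\<Sum>n. \<integral>\<^sup>+z. ennreal (f z) * indicator (A n) z \<partial>Q)"
  proof (rule nn_integral_suminf)
    fix n
    note [measurable] = sets_path_filtration(2)[OF A_F]
    show "(\<lambda>z. ennreal (f z) * indicator (A n) z) \<in> borel_measurable Q" by measurable
  qed
  also have "\<dots> = ennreal d * (\<Sum>n. emeasure P (A n))"
    by (simp add: part ennreal_suminf_cmult)
  also have "(\<Sum>n. emeasure P (A n)) = emeasure P (\<Union>n. A n)"
    using sets_path_filtration(3)[OF A_F] disj by (intro suminf_emeasure) auto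
  finally show ?thesis
    unfolding Un_A f_def d_def .
qed

end

section \<open>Transfer to the ruin probability\<close>

theorem theorem10:
  fixes M :: "'a measure" and Y T :: "nat \<Rightarrow> 'a \<Rightarrow> real"
    and \<xi> lam1 lam2 \<beta> \<kappa> x :: real
    and v :: "real^2" and Q :: "(nat \<Rightarrow> real \<times> 2) measure"
  assumes "risk_model M Y T \<xi> lam1 lam2 \<beta>"
    and "AE \<omega> in M. filterlim (\<lambda>t. surplus Y T x t \<omega>) at_top at_top"
    and "0 < \<kappa>" "\<kappa> < \<beta>"
    and "(\<integral>\<omega>. exp (\<kappa> * cycle_increment \<xi> Y T \<omega>) \<partial>M) = 1"
    and "F_hat \<xi> lam1 lam2 \<beta> \<kappa> *v v = v" "v $ 1 > 0" "v $ 2 > 0"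
    and "tilted_law (embedded_law M \<xi> Y T) \<kappa> v Q"
    and "x \<ge> 0"
  shows "(AE z in Q. passage_time x z < \<infinity>) \<and>
    ruin_prob M Y T x =
      v $ 2 * exp (- \<kappa> * x) *
        (\<integral>z. exp (- \<kappa> * overshoot x z) / v $ passage_state x z \<partial>Q)"
proof -
  interpret risk_model M Y T \<xi> lam1 lam2 \<beta> by fact
  define P where "P = embedded_law M \<xi> Y T"
  define Z where "Z \<omega> n = (claim_surplus Y T n \<omega>, phase \<xi> T n \<omega>)" for \<omega> n
  have Z [measurable]: "Z \<in> measurable M path_space"
    using path_measurable by (simp add: Z_def[abs_def])
  have P: "P = distr M path_space Z"
    by (simp add: P_def embedded_law_def Z_def[abs_def])
  have sets_P: "sets P = sets path_space"
    by (simp add: P)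
  interpret P: prob_space P
    unfolding P by (rule prob_space_distr) measurable
  have v_pos: "v $ i > 0" for i
    using assms(7,8) by (metis exhaust_2)
  note tilted = assms(9)[folded P_def]
  note [measurable] = component_measurable_path_space
  have lim: "AE z in P. filterlim (\<lambda>n. fst (z n)) at_bot sequentially"
  proof -
    \<comment> \<open>Countable quantifiers make the event of divergence measurable, as transfer
      through the image measure requires.\<close>
    have *: "filterlim (\<lambda>n. fst (z n)) at_bot sequentially \<longleftrightarrow>
        (\<forall>N. \<exists>m. \<forall>n\<ge>m. fst (z n) \<le> - real N)" for z :: "nat \<Rightarrow> real \<times> 2"
    proof
      assume lim: "\<forall>N. \<exists>m. \<forall>n\<ge>m. fst (z n) \<le> - real N"
      show "filterlim (\<lambda>n. fst (z n)) at_bot sequentially"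
        unfolding filterlim_at_bot eventually_sequentially
      proof
        fix C :: real
        obtain N where "- C \<le> real N" using real_arch_simple by blast
        with lim show "\<exists>m. \<forall>n\<ge>m. fst (z n) \<le> C" by (meson minus_le_iff order_trans)
      qed
    qed (simp add: filterlim_at_bot eventually_sequentially)
    have meas: "{z \<in> space path_space. filterlim (\<lambda>n. fst (z n)) at_bot sequentially} \<in> sets path_space"
      unfolding * by measurable
    show ?thesis
      using AE_claim_surplus_at_bot[OF assms(2)]
      unfolding P AE_distr_iff[OF Z meas] by (simp add: Z_def)
  qed
  have initial: "AE z in P. snd (z 0) = 2"
  proof -
    have meas: "{z \<in> space path_space. snd (z 0) = 2} \<in> sets path_space" by measurable
    show ?thesis
      unfolding P AE_distr_iff[OF Z meas] by (simp add: Z_def phase_def)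
  qed
  have AE_Q: "AE z in Q. passage_time x z < \<infinity>"
    by (rule AE_passage_time_finite[OF tilted sets_P v_pos P.finite_measure_axioms assms(3) lim])
  let ?d = "exp (\<kappa> * x) / v $ 2"
  have "emeasure P {z. \<exists>n. fst (z n) > x} = emeasure M {\<omega> \<in> space M. \<exists>n. claim_surplus Y T n \<omega> > x}"
  proof -
    have "{z \<in> space path_space. \<exists>n. fst (z n) > x} \<in> sets path_space" by measurable
    then show ?thesis
      unfolding P by (subst emeasure_distr) (auto simp: Z_def intro!: arg_cong[where f="emeasure M"])
  qed
  also have "\<dots> = ennreal (ruin_prob M Y T x)"
    by (simp add: ruin_prob_eq_claim_surplus[OF assms(10)] emeasure_eq_measure)
  finally have "(\<integral>\<^sup>+z. ennreal (exp (- \<kappa> * overshoot x z) / v $ passage_state x z) \<partial>Q) =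
      ennreal (?d * ruin_prob M Y T x)"
    using v_pos[of 2] nn_integral_overshoot[OF tilted sets_P v_pos AE_Q initial]
    by (simp only: ennreal_mult' divide_nonneg_pos exp_ge_zero)
  moreover have "(\<lambda>z. exp (- \<kappa> * overshoot x z) / v $ passage_state x z) \<in> borel_measurable Q"
    using measurable_overshoot_state
    by (simp only: measurable_cong_sets[OF sets_tilted_law[OF tilted] refl])
  \<comment> \<open>The integrand is nonnegative and measurable and its extended integral is finite,
    so the real integral has the same value.\<close>
  ultimately have "(\<integral>z. exp (- \<kappa> * overshoot x z) / v $ passage_state x z \<partial>Q) = ?d * ruin_prob M Y T x"
    using v_pos by (subst integral_eq_nn_integral) (auto simp: ruin_prob_def less_imp_le)
  \<comment> \<open>The prefactor is the reciprocal of \<open>?d\<close>.\<close>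
  then have "v $ 2 * exp (- \<kappa> * x) * (\<integral>z. exp (- \<kappa> * overshoot x z) / v $ passage_state x z \<partial>Q) =
      ruin_prob M Y T x"
    using v_pos[of 2] by (simp add: exp_minus)
  with AE_Q show ?thesis by simp
qed

end
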